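(* Let $\Gamma=(V,E)$ be a graph of order $n$. Then: (1) $A(\Gamma;1)<2^n$, and $A(\Gamma;1)$ equals the number of nonempty subsets $S\subseteq V$ such that the induced subgraph $\langle S\rangle$ is connected; (2) the number of cut vertex sets of $\Gamma$ equals $2^n-1-A(\Gamma;1)$.
   Context: All graphs are finite and simple with at least one vertex. A cut vertex set of $\Gamma=(V,E)$ is a subset $X\subsetneq V$ such that the subgraph induced by $V\setminus X$ is not connected. For a vertex $v$ and $X\subseteq V$, $\delta_X(v)$ is the number of neighbours of $v$ in $X$, $\delta_1$ the maximum degree, $\bar S=V\setminus S$, and $\mathcal{K}=[-\delta_1,\delta_1]\cap\mathbb{Z}$. A nonempty $S\subseteq V$ is a defensive $k$-alliance if $\delta_S(v)\ge\delta_{\bar S}(v)+k$ for all $v\in S$; its exact index of alliance is $k_S=\max\{k\in\mathcal{K}: S \text{ is a defensive } k\text{-alliance}\}$. The alliance polynomial is $A(\Gamma;x)=\sum_{S} x^{n+k_S}$, the sum over all nonempty $S\subseteq V$ with $\langle S\rangle$ connected. *)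

theory Defs
  imports "Graph_Theory.Digraph_Component" "HOL-Computational_Algebra.Polynomial"
begin

text \<open>
  Finite simple graphs are the symmetric, loop-free digraphs without parallel arcs of the
  locale \<^locale>\<open>graph\<close>: an undirected edge \<open>uv\<close> is the pair of arcs \<open>(u,v)\<close>, \<open>(v,u)\<close>.
  The constant \<open>connected\<close> of the graph library is always written with its qualifier, since
  \<open>Complex_Main\<close> has a topological notion of the same name.
\<close>

definition cut_vertex_set :: "('a, 'b) pre_digraph \<Rightarrow> 'a set \<Rightarrow> bool" where
  "cut_vertex_set G X \<longleftrightarrow>
     X \<subset> verts G \<and> \<not> Digraph_Component.connected (G \<restriction> (verts G - X))"

definition degree_in :: "('a, 'b) pre_digraph \<Rightarrow> 'a set \<Rightarrow> 'a \<Rightarrow> nat" where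
  "degree_in G X v = card {u \<in> X. v \<rightarrow>\<^bsub>G\<^esub> u}"

definition max_degree :: "('a, 'b) pre_digraph \<Rightarrow> nat" where
  "max_degree G = Max (degree_in G (verts G) ` verts G)"

definition defensive_alliance :: "('a, 'b) pre_digraph \<Rightarrow> int \<Rightarrow> 'a set \<Rightarrow> bool" where
  "defensive_alliance G k S \<longleftrightarrow>
     S \<noteq> {} \<and> S \<subseteq> verts G \<and>
     (\<forall>v\<in>S. int (degree_in G S v) \<ge> int (degree_in G (verts G - S) v) + k)"

definition alliance_index :: "('a, 'b) pre_digraph \<Rightarrow> 'a set \<Rightarrow> int" where
  "alliance_index G S =
     Max {k \<in> {- int (max_degree G)..int (max_degree G)}. defensive_alliance G k S}"

definition connected_vertex_sets :: "('a, 'b) pre_digraph \<Rightarrow> 'a set set" where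
  "connected_vertex_sets G =
     {S. S \<noteq> {} \<and> S \<subseteq> verts G \<and> Digraph_Component.connected (G \<restriction> S)}"

text \<open>
  The conversion \<open>nat\<close> in the exponent does not truncate, and the maximum defining the index is
  taken over a nonempty finite set; see \<open>alliance_index_wf\<close> and \<open>alliance_exponent_pos\<close> below.
\<close>

definition alliance_poly :: "('a, 'b) pre_digraph \<Rightarrow> int poly" where
  "alliance_poly G =
     (\<Sum>S\<in>connected_vertex_sets G. monom 1 (nat (int (card (verts G)) + alliance_index G S)))"

context graph
begin

lemma degree_in_le_max:
  assumes "v \<in> verts G" "X \<subseteq> verts G"
  shows "degree_in G X v \<le> max_degree G"
proof -
  have "degree_in G X v \<le> degree_in G (verts G) v"
    unfolding degree_in_def using assms(2) by (intro card_mono) auto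
  also have "\<dots> \<le> max_degree G"
    unfolding max_degree_def using assms(1) by (intro Max_ge) auto
  finally show ?thesis .
qed

lemma max_degree_less_card:
  assumes "verts G \<noteq> {}"
  shows "max_degree G < card (verts G)"
proof -
  have "degree_in G (verts G) v < card (verts G)" if "v \<in> verts G" for v
  proof -
    have "\<not> v \<rightarrow>\<^bsub>G\<^esub> v"
      using no_loops by (auto simp: arcs_ends_def arc_to_ends_def)
    then show ?thesis
      unfolding degree_in_def using that by (intro psubset_card_mono) auto
  qed
  then show ?thesis
    unfolding max_degree_def using assms by (subst Max_less_iff) auto
qed

lemma alliance_index_wf:
  assumes "S \<noteq> {}" "S \<subseteq> verts G"
  shows "alliance_index G S \<in> {- int (max_degree G)..int (max_degree G)}"
    and "defensive_alliance G (alliance_index G S) S"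
proof -
  let ?K = "{k \<in> {- int (max_degree G)..int (max_degree G)}. defensive_alliance G k S}"
  have "defensive_alliance G (- int (max_degree G)) S"
    unfolding defensive_alliance_def
  proof (intro conjI ballI)
    fix v assume "v \<in> S"
    then have "degree_in G (verts G - S) v \<le> max_degree G"
      using assms by (intro degree_in_le_max) auto
    then show "int (degree_in G S v) \<ge> int (degree_in G (verts G - S) v) + - int (max_degree G)"
      by linarith
  qed (use assms in auto)
  then have "- int (max_degree G) \<in> ?K" by simp
  moreover have "finite ?K"
    by (rule finite_subset[of _ "{- int (max_degree G)..int (max_degree G)}"]) auto
  ultimately have "Max ?K \<in> ?K" by (intro Max_in) blast+
  then show "alliance_index G S \<in> {- int (max_degree G)..int (max_degree G)}"
    and "defensive_alliance G (alliance_index G S) S"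
    unfolding alliance_index_def by auto
qed

lemma alliance_exponent_pos:
  assumes "S \<noteq> {}" "S \<subseteq> verts G"
  shows "int (card (verts G)) + alliance_index G S > 0"
  using alliance_index_wf(1)[OF assms] max_degree_less_card assms by fastforce

end

end

theory Submission
  imports Defs
begin

text \<open>At 1 every monomial of the alliance polynomial contributes 1, whatever its exponent, so
  the value counts the connected vertex sets. Complementation turns cut vertex sets into the
  nonempty vertex sets that induce a disconnected subgraph
  (\<open>bij_betw_cut_vertex_sets\<close>). Both kinds together exhaust the 2^n - 1 nonempty
  subsets.\<close>

lemma poly_alliance_poly_1:
  "poly (alliance_poly G) 1 = int (card (connected_vertex_sets G))"
  by (simp add: alliance_poly_def poly_sum poly_monom)

text \<open>Complementation in \<open>verts G\<close> is its own inverse; properness of a cut vertex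
  set X is exactly nonemptiness of its complement.\<close>

lemma bij_betw_cut_vertex_sets:
  "bij_betw (\<lambda>X. verts G - X) {X. cut_vertex_set G X}
     (Pow (verts G) - {{}} - connected_vertex_sets G)"
proof (rule bij_betw_byWitness[where f' = "\<lambda>S. verts G - S"])
  show "(\<lambda>S. verts G - S) ` (Pow (verts G) - {{}} - connected_vertex_sets G)
          \<subseteq> {X. cut_vertex_set G X}"
    by (auto simp: cut_vertex_set_def connected_vertex_sets_def double_diff)
qed (auto simp: cut_vertex_set_def connected_vertex_sets_def)

lemma card_cut_vertex_sets:
  assumes "finite (verts G)"
  shows "card {X. cut_vertex_set G X} + card (connected_vertex_sets G) + 1 = 2 ^ card (verts G)"
proof -
  let ?P = "Pow (verts G)"
  have sub: "connected_vertex_sets G \<subseteq> ?P - {{}}"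
    by (auto simp: connected_vertex_sets_def)
  have "card {X. cut_vertex_set G X} + card (connected_vertex_sets G) = card (?P - {{}})"
    \<comment> \<open>\<open>card_mono\<close> ensures that the natural-number subtraction from
      \<open>card_Diff_subset\<close> does not truncate.\<close>
    using assms sub bij_betw_same_card[OF bij_betw_cut_vertex_sets, of G]
      card_Diff_subset[OF finite_subset[OF sub] sub] card_mono[OF _ sub]
    by simp
  also have "\<dots> + 1 = 2 ^ card (verts G)"
    using assms by (simp add: card_Diff_singleton card_Pow)
  finally show ?thesis .
qed

theorem theorem2p4:
  fixes G :: "('a, 'b) pre_digraph" and n :: nat
  assumes "graph G" and "verts G \<noteq> {}" and "card (verts G) = n"
  shows "(poly (alliance_poly G) 1 < 2 ^ n \<and>
          poly (alliance_poly G) 1 =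
            int (card {S. S \<noteq> {} \<and> S \<subseteq> verts G \<and> Digraph_Component.connected (G \<restriction> S)})) \<and>
         int (card {X. cut_vertex_set G X}) = 2 ^ n - 1 - poly (alliance_poly G) 1"
proof -
  interpret graph G by fact
  have "int (card {X. cut_vertex_set G X} + card (connected_vertex_sets G) + 1) = int (2 ^ n)"
    using card_cut_vertex_sets[OF finite_verts] assms(3) by simp
  then have "int (card {X. cut_vertex_set G X}) + poly (alliance_poly G) 1 + 1 = 2 ^ n"
    by (simp add: poly_alliance_poly_1)
  moreover have "poly (alliance_poly G) 1 =
      int (card {S. S \<noteq> {} \<and> S \<subseteq> verts G \<and> Digraph_Component.connected (G \<restriction> S)})"
    by (simp add: poly_alliance_poly_1 connected_vertex_sets_def)
  \<comment> \<open>The bound is strict because the empty set supplies the summand 1 and the number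
    of cut vertex sets is nonnegative.\<close>
  ultimately show ?thesis by linarith
qed

end
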